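(* Let $\mathcal{Y}$ be a finite set, $\mathcal{U}$ a Polish space, $\Theta\subseteq\mathbb{R}^{d_\theta}$ open, and $X$ a random element. For each value $x$ of $X$ let $P(\cdot\vert x)$ be the conditional distribution of the outcome $Y$ on $\mathcal{Y}$ given $X=x$, and for each $\theta\in\Theta$ let $\nu(\cdot\vert x;\theta)$ be a probability measure on $\mathcal{U}$ and $\epsilon\mapsto G(\epsilon\vert x;\theta)\subseteq\mathcal{Y}$ a measurable correspondence. Let $\mathcal{U}^\ast=\{G(\epsilon\vert X;\theta):\epsilon\in\mathcal{U}\}\subseteq 2^{\mathcal{Y}}$, let $Q(u\vert X;\theta)=\nu(\{\epsilon: G(\epsilon\vert X;\theta)=u\}\vert X;\theta)$ for $u\in\mathcal{U}^\ast$, and let $\mathcal{G}(X;\theta)=\{(y,u)\in\mathcal{Y}\times\mathcal{U}^\ast: y\in u\}$. Then a parameter value $\theta\in\Theta$ belongs to the identified set $\Theta_I$ if and only if, $X$-almost surely, there exists a probability on $\mathcal{Y}\times\mathcal{U}^\ast$ supported on $\mathcal{G}(X;\theta)$ with marginal probabilities $P(\cdot\vert X)$ on $\mathcal{Y}$ and $Q(\cdot\vert X;\theta)$ on $\mathcal{U}^\ast$.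
   Context: Measurable correspondence: for almost all $x$ and all $\theta$, for every $A\subseteq\mathcal{Y}$ the set $\{\epsilon\in\mathcal{U}: G(\epsilon\vert x;\theta)\cap A\ne\varnothing\}$ is measurable. The identified set $\Theta_I$ is the set of $\theta\in\Theta$ for which there exists an equilibrium selection mechanism compatible with the data. An equilibrium selection mechanism (at $\theta$) is a conditional probability $\pi(\cdot\vert\epsilon,X)$ on $\mathcal{Y}$ given $(\epsilon,X)$ with support contained in $G(\epsilon\vert X;\theta)$, i.e. for almost every value $x$ of $X$ a probability kernel $\epsilon\mapsto\pi(\cdot\vert\epsilon,x)$ with $\pi(G(\epsilon\vert x;\theta)\vert\epsilon,x)=1$ for $\nu(\cdot\vert x;\theta)$-almost every $\epsilon$. It is compatible with the data if for almost every $x$ and all $A\subseteq\mathcal{Y}$, $P(A\vert x)=\int_{\mathcal{U}}\pi(A\vert\epsilon,x)\,\nu(d\epsilon\vert x;\theta)$. Existence is understood value by value of $X$. *)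

theory Defs
  imports "HOL-Probability.Probability"
begin

text \<open>
  The finite outcome set is a type of class \<open>finite\<close>, and the space of latent variables is a
  type of class \<open>polish_space\<close> with its Borel sigma-algebra. Probability kernels are measurable maps
  into \<open>prob_algebra\<close>.
\<close>

text \<open>
  \<open>P\<close> is a (regular) conditional distribution of \<open>Y\<close> given \<open>X\<close>, where \<open>X\<close> takes values in the
  measurable space \<open>S\<close>.
\<close>

definition conditional_distribution ::
  "'w measure \<Rightarrow> 'x measure \<Rightarrow> ('w \<Rightarrow> 'x) \<Rightarrow> ('w \<Rightarrow> 'y) \<Rightarrow> ('x \<Rightarrow> 'y measure) \<Rightarrow> bool" where
  "conditional_distribution M S X Y P \<longleftrightarrow>
     P \<in> S \<rightarrow>\<^sub>M prob_algebra (count_space UNIV) \<and>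
     (\<forall>A. \<forall>B\<in>sets S.
        measure M {\<omega>\<in>space M. X \<omega> \<in> B \<and> Y \<omega> \<in> A} = (LINT x:B|distr M S X. measure (P x) A))"

definition measurable_correspondence :: "('u::topological_space \<Rightarrow> 'y set) \<Rightarrow> bool" where
  "measurable_correspondence g \<longleftrightarrow> (\<forall>A. {\<epsilon>. g \<epsilon> \<inter> A \<noteq> {}} \<in> sets borel)"

text \<open>
  In the next two definitions \<open>L\<close> is the law of \<open>X\<close>, and \<open>\<nu>\<close> and \<open>G\<close> are taken at a fixed parameter
  value. A mechanism \<open>\<pi>\<close> is chosen separately at each \<open>x\<close>: it is measurable in \<open>\<epsilon>\<close>, but no
  measurability in \<open>x\<close> is imposed.
\<close>

definition selection_mechanism ::
  "'x measure \<Rightarrow> ('x \<Rightarrow> 'u::polish_space measure) \<Rightarrow> ('x \<Rightarrow> 'u \<Rightarrow> 'y set) \<Rightarrow>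
   ('x \<Rightarrow> 'u \<Rightarrow> 'y measure) \<Rightarrow> bool" where
  "selection_mechanism L \<nu> G \<pi> \<longleftrightarrow>
     (AE x in L. \<pi> x \<in> borel \<rightarrow>\<^sub>M prob_algebra (count_space UNIV) \<and>
                 (AE \<epsilon> in \<nu> x. measure (\<pi> x \<epsilon>) (G x \<epsilon>) = 1))"

definition compatible_with_data ::
  "'x measure \<Rightarrow> ('x \<Rightarrow> 'y measure) \<Rightarrow> ('x \<Rightarrow> 'u::polish_space measure) \<Rightarrow>
   ('x \<Rightarrow> 'u \<Rightarrow> 'y measure) \<Rightarrow> bool" where
  "compatible_with_data L P \<nu> \<pi> \<longleftrightarrow>
     (AE x in L. \<forall>A. measure (P x) A = (LINT \<epsilon>|\<nu> x. measure (\<pi> x \<epsilon>) A))"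

definition identified_set ::
  "'t set \<Rightarrow> 'x measure \<Rightarrow> ('x \<Rightarrow> 'y measure) \<Rightarrow> ('x \<Rightarrow> 't \<Rightarrow> 'u::polish_space measure) \<Rightarrow>
   ('x \<Rightarrow> 't \<Rightarrow> 'u \<Rightarrow> 'y set) \<Rightarrow> 't set" where
  "identified_set \<Theta> L P \<nu> G =
     {\<theta>\<in>\<Theta>. \<exists>\<pi>. selection_mechanism L (\<lambda>x. \<nu> x \<theta>) (\<lambda>x. G x \<theta>) \<pi> \<and>
                compatible_with_data L P (\<lambda>x. \<nu> x \<theta>) \<pi>}"

text \<open>
  The set \<open>\<U>\<^sup>*\<close>, the mass function \<open>Q\<close> and the admissible pairs \<open>\<G>\<close>, for a fixed
  value of \<open>X\<close> and of the parameter; \<open>g\<close> stands for \<open>G x \<theta>\<close> and \<open>N\<close> for \<open>\<nu> x \<theta>\<close>.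
\<close>

definition predicted_sets :: "('u \<Rightarrow> 'y set) \<Rightarrow> 'y set set" where
  "predicted_sets g = {g \<epsilon> |\<epsilon>. True}"

definition predicted_mass :: "'u measure \<Rightarrow> ('u \<Rightarrow> 'y set) \<Rightarrow> 'y set \<Rightarrow> real" where
  "predicted_mass N g u = measure N {\<epsilon>. g \<epsilon> = u}"

definition admissible_pairs :: "('u \<Rightarrow> 'y set) \<Rightarrow> ('y \<times> 'y set) set" where
  "admissible_pairs g = {(y, u). u \<in> predicted_sets g \<and> y \<in> u}"

end

theory Submission imports Defs begin

text \<open>
  Everything happens at a single value of \<open>X\<close>. A mechanism \<open>\<pi>\<close> yields the joint law of the
  selected outcome and the predicted set, with mass \<open>\<integral> 1{g \<epsilon> = u} \<pi>({y}|\<epsilon>) N(d\<epsilon>)\<close> at \<open>(y, u)\<close>.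
  Conversely, a joint law \<open>\<gamma>\<close> is disintegrated along its second marginal, which is the law of \<open>g\<close>
  under \<open>N\<close>, and the mechanism draws from the conditional law of the outcome given \<open>u = g \<epsilon>\<close>.
\<close>

section \<open>Conditional laws of the outcome and measurability of the predicted set\<close>

definition conditional_fst :: "('a \<times> 'b) pmf \<Rightarrow> 'b \<Rightarrow> 'a pmf" where
  "conditional_fst \<gamma> u = map_pmf fst (cond_pmf \<gamma> (snd -` {u}))"

text \<open>This is the multiplication rule for conditional probability. In product form it needs no
  positivity hypothesis: if \<open>u\<close> is a null value of the second component,
  \<open>conditional_fst \<gamma> u\<close> is an unspecified pmf, but its weight is zero and so is
  the left-hand side.\<close>

lemma measure_conditional_fst:
  fixes \<gamma> :: "('a \<times> 'b) pmf"
  shows "measure \<gamma> (A \<times> {u}) = pmf (map_pmf snd \<gamma>) u * measure (conditional_fst \<gamma> u) A"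
proof (cases "u \<in> snd ` set_pmf \<gamma>")
  case True
  then have ne: "set_pmf \<gamma> \<inter> snd -` {u} \<noteq> {}" by auto
  have "measure (conditional_fst \<gamma> u) A = measure (uniform_measure \<gamma> (snd -` {u})) (fst -` A)"
    by (simp add: conditional_fst_def cond_pmf.rep_eq[OF ne])
  also have "\<dots> = measure \<gamma> (snd -` {u} \<inter> fst -` A) / measure \<gamma> (snd -` {u})"
    by (intro measure_uniform_measure) (auto simp: emeasure_measure_pmf_not_zero[OF ne])
  also have "snd -` {u} \<inter> fst -` A = A \<times> {u}" by auto
  finally show ?thesis
    using measure_measure_pmf_not_zero[OF ne] by (simp add: pmf_map)
next
  case False
  then have "pmf (map_pmf snd \<gamma>) u = 0" by (simp add: pmf_eq_0_set_pmf)
  moreover have "set_pmf \<gamma> \<inter> A \<times> {u} = {}" using False by force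
  ultimately show ?thesis by (simp add: measure_pmf_zero_iff)
qed

lemma set_conditional_fst:
  assumes "u \<in> snd ` set_pmf \<gamma>"
  shows "set_pmf (conditional_fst \<gamma> u) = {y. (y, u) \<in> set_pmf \<gamma>}"
proof -
  have ne: "set_pmf \<gamma> \<inter> snd -` {u} \<noteq> {}" using assms by auto
  show ?thesis by (force simp: conditional_fst_def set_cond_pmf[OF ne])
qed

text \<open>Hitting the singleton of \<open>y\<close> means containing \<open>y\<close>, so every
  membership event is Borel. Since the outcome type is finite, a level set of \<open>g\<close> is a
  finite intersection of such events and their complements. There are only finitely many level sets,
  so they settle measurability into the discrete space of subsets.\<close>

lemma measurable_correspondence_count_space:
  fixes g :: "'u::topological_space \<Rightarrow> 'y::finite set"
  assumes "measurable_correspondence g"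
  shows "g \<in> borel \<rightarrow>\<^sub>M count_space UNIV"
proof -
  have in_g: "{\<epsilon>. y \<in> g \<epsilon>} \<in> sets borel" for y
    using assms unfolding measurable_correspondence_def by (auto dest: spec[of _ "{y}"])
  have [measurable]: "Measurable.pred borel (\<lambda>\<epsilon>. y \<in> g \<epsilon>)" for y
    using in_g[of y] by (simp add: pred_def)
  have "{\<epsilon>. \<forall>y. y \<in> g \<epsilon> \<longleftrightarrow> y \<in> u} \<in> sets borel" for u
    by measurable
  then have "g -` {u} \<in> sets borel" for u
    by (simp add: set_eq_iff vimage_def)
  then show ?thesis
    by (subst measurable_count_space_eq2) auto
qed

section \<open>From a selection mechanism to a joint law\<close>

lemma selection_kernel_imp_coupling:
  fixes N :: "'u measure" and g :: "'u \<Rightarrow> 'y::finite set" and \<pi> :: "'u \<Rightarrow> 'y measure"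
  assumes "prob_space N"
    and g [measurable]: "g \<in> N \<rightarrow>\<^sub>M count_space UNIV"
    and \<pi> [measurable]: "\<pi> \<in> N \<rightarrow>\<^sub>M prob_algebra (count_space UNIV)"
    and supp: "AE \<epsilon> in N. measure (\<pi> \<epsilon>) (g \<epsilon>) = 1"
  obtains \<gamma> :: "('y \<times> 'y set) pmf"
  where "set_pmf \<gamma> \<subseteq> {(y, u). u \<in> g ` space N \<and> y \<in> u}"
    and "\<And>y. pmf (map_pmf fst \<gamma>) y = (LINT \<epsilon>|N. measure (\<pi> \<epsilon>) {y})"
    and "\<And>u. pmf (map_pmf snd \<gamma>) u = measure N {\<epsilon>\<in>space N. g \<epsilon> = u}"
proof -
  interpret N: prob_space N by fact
  have prob: "prob_space (\<pi> \<epsilon>)" and sets_\<pi>: "sets (\<pi> \<epsilon>) = UNIV" if "\<epsilon> \<in> space N" for \<epsilon>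
    using measurable_space[OF \<pi> that] by (auto simp: space_prob_algebra)
  have [measurable]: "(\<lambda>\<epsilon>. measure (\<pi> \<epsilon>) A) \<in> borel_measurable N" for A
    by (rule measurable_compose[OF \<pi> measurable_measure_prob_algebra]) simp
  have [measurable]: "Measurable.pred N (\<lambda>\<epsilon>. g \<epsilon> = u)" for u
    by measurable
  \<comment> \<open>For fixed \<epsilon> in the space of \<open>N\<close>, \<open>h\<close> is the
    mass function of the product of \<open>\<pi> \<epsilon>\<close> with the point mass at
    \<open>g \<epsilon>\<close>. The marginals, the total mass and the support of \<open>f\<close>
    come from integrating the corresponding pointwise facts about \<open>h\<close>.\<close>
  define h where "h = (\<lambda>y u \<epsilon>. indicator {\<epsilon>. g \<epsilon> = u} \<epsilon> * measure (\<pi> \<epsilon>) {y})"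
  define f where "f = (\<lambda>(y, u). LINT \<epsilon>|N. h y u \<epsilon>)"
  have h_int: "integrable N (h y u)" for y u
  proof (rule N.integrable_const_bound[where B=1])
    show "AE \<epsilon> in N. norm (h y u \<epsilon>) \<le> 1"
      using prob by (auto simp: h_def prob_space.prob_le_1 split: split_indicator)
    show "h y u \<in> borel_measurable N"
      unfolding h_def indicator_def by simp
  qed
  have sum_h_snd: "(\<Sum>u\<in>UNIV. h y u \<epsilon>) = measure (\<pi> \<epsilon>) {y}" for y \<epsilon>
    by (simp add: h_def indicator_def if_distrib[of "\<lambda>c. c * _"] cong: if_cong)
  have sum_\<pi>: "(\<Sum>y\<in>UNIV. measure (\<pi> \<epsilon>) {y}) = 1" if "\<epsilon> \<in> space N" for \<epsilon>
  proof -
    interpret prob_space "\<pi> \<epsilon>" using prob[OF that] .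
    have "measure (\<pi> \<epsilon>) UNIV = (\<Sum>y\<in>UNIV. measure (\<pi> \<epsilon>) {y})"
      by (intro measure_eq_sum_singleton) (auto simp: sets_\<pi>[OF that])
    moreover have "space (\<pi> \<epsilon>) = UNIV"
      using sets_eq_imp_space_eq[of "\<pi> \<epsilon>" "count_space UNIV"] sets_\<pi>[OF that] by simp
    ultimately show ?thesis using prob_space by simp
  qed
  have sum_f_snd: "(\<Sum>u\<in>UNIV. f (y, u)) = (LINT \<epsilon>|N. measure (\<pi> \<epsilon>) {y})" for y
    by (simp add: f_def h_int sum_h_snd flip: Bochner_Integration.integral_sum)
  have sum_f_fst: "(\<Sum>y\<in>UNIV. f (y, u)) = measure N {\<epsilon>\<in>space N. g \<epsilon> = u}" for u
  proof -
    have "(\<Sum>y\<in>UNIV. f (y, u)) = (LINT \<epsilon>|N. (\<Sum>y\<in>UNIV. h y u \<epsilon>))"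
      by (simp add: f_def h_int Bochner_Integration.integral_sum)
    also have "\<dots> = (LINT \<epsilon>|N. indicator {\<epsilon>\<in>space N. g \<epsilon> = u} \<epsilon>)"
      by (intro Bochner_Integration.integral_cong)
         (auto simp: h_def sum_\<pi> split: split_indicator simp flip: sum_distrib_left)
    finally show ?thesis by simp
  qed
  have f_nonneg: "0 \<le> f z" for z
    by (auto simp: f_def h_def split: prod.split intro!: Bochner_Integration.integral_nonneg)
  have "(\<Sum>z\<in>UNIV. f z) = (\<Sum>y\<in>UNIV. \<Sum>u\<in>UNIV. f (y, u))"
    unfolding sum.cartesian_product UNIV_Times_UNIV by simp
  also have "\<dots> = (LINT \<epsilon>|N. (\<Sum>y\<in>UNIV. \<Sum>u\<in>UNIV. h y u \<epsilon>))"
    by (simp add: f_def h_int Bochner_Integration.integral_sum)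
  also have "\<dots> = (LINT \<epsilon>|N. 1)"
    by (intro Bochner_Integration.integral_cong) (auto simp: sum_h_snd sum_\<pi>)
  finally have f_sum: "(\<Sum>z\<in>UNIV. f z) = 1" by (simp add: N.prob_space)
  have "(\<integral>\<^sup>+z. ennreal (f z) \<partial>count_space UNIV) = 1"
    by (simp add: nn_integral_count_space_finite sum_ennreal f_nonneg f_sum)
  then have pmf_f: "pmf (embed_pmf f) z = f z" for z
    using f_nonneg by (intro pmf_embed_pmf) auto
  have f_zero: "f (y, u) = 0" if "\<not> (u \<in> g ` space N \<and> y \<in> u)" for y u
  proof -
    \<comment> \<open>If \<open>g \<epsilon>\<close> differs from \<open>u\<close>, the indicator
      vanishes. Otherwise \<epsilon> itself shows that \<open>u\<close> is a value of
      \<open>g\<close>, so the excluded pair must fail through \<open>y\<close> lying outside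
      \<open>u = g \<epsilon>\<close>, and there the mechanism puts no mass.\<close>
    have "AE \<epsilon> in N. h y u \<epsilon> = 0"
      using supp AE_space
    proof eventually_elim
      case (elim \<epsilon>)
      interpret prob_space "\<pi> \<epsilon>" using prob[OF elim(2)] .
      have "measure (\<pi> \<epsilon>) {y} = 0" if "y \<notin> g \<epsilon>"
      proof -
        \<comment> \<open>The set \<open>g \<epsilon>\<close> already carries mass one, so a
          positive mass at a further point would push the total above one.\<close>
        have "measure (\<pi> \<epsilon>) (insert y (g \<epsilon>)) = measure (\<pi> \<epsilon>) {y} + measure (\<pi> \<epsilon>) (g \<epsilon>)"
          using that finite_measure_Union[of "{y}" "g \<epsilon>"] by (simp add: sets_\<pi>[OF elim(2)])
        with elim(1) prob_le_1[of "insert y (g \<epsilon>)"] measure_nonneg[of "\<pi> \<epsilon>" "{y}"]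
        show ?thesis by simp
      qed
      with \<open>\<not> (u \<in> g ` space N \<and> y \<in> u)\<close> elim(2) show ?case
        by (auto simp: h_def split: split_indicator)
    qed
    then show ?thesis by (simp add: f_def integral_eq_zero_AE)
  qed
  show ?thesis
  proof
    show "set_pmf (embed_pmf f) \<subseteq> {(y, u). u \<in> g ` space N \<and> y \<in> u}"
    proof (rule subrelI)
      fix y u assume "(y, u) \<in> set_pmf (embed_pmf f)"
      then have "f (y, u) \<noteq> 0" by (simp add: set_pmf_iff pmf_f)
      then have "u \<in> g ` space N \<and> y \<in> u" using f_zero[of u y] by argo
      then show "(y, u) \<in> {(y, u). u \<in> g ` space N \<and> y \<in> u}" by simp
    qed
    show "pmf (map_pmf fst (embed_pmf f)) y = (LINT \<epsilon>|N. measure (\<pi> \<epsilon>) {y})" for y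
    proof -
      have "fst -` {y} = Pair y ` (UNIV :: 'y set set)" by auto
      then have "pmf (map_pmf fst (embed_pmf f)) y = (\<Sum>u\<in>UNIV. f (y, u))"
        by (simp add: pmf_map measure_measure_pmf_finite pmf_f sum.reindex inj_on_def)
      then show ?thesis by (simp add: sum_f_snd)
    qed
    show "pmf (map_pmf snd (embed_pmf f)) u = measure N {\<epsilon>\<in>space N. g \<epsilon> = u}" for u
    proof -
      have "snd -` {u} = (\<lambda>y. (y, u)) ` (UNIV :: 'y set)"
        by (simp add: set_eq_iff image_iff)
      then have "pmf (map_pmf snd (embed_pmf f)) u = (\<Sum>y\<in>UNIV. f (y, u))"
        by (simp add: pmf_map measure_measure_pmf_finite pmf_f sum.reindex inj_on_def)
      then show ?thesis by (simp add: sum_f_fst)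
    qed
  qed
qed

section \<open>From a joint law to a selection mechanism\<close>

lemma coupling_imp_selection_kernel:
  fixes N :: "'u measure" and g :: "'u \<Rightarrow> 'y::finite set" and \<gamma> :: "('y \<times> 'y set) pmf"
  assumes "prob_space N"
    and g [measurable]: "g \<in> N \<rightarrow>\<^sub>M count_space UNIV"
    and supp: "\<And>y u. (y, u) \<in> set_pmf \<gamma> \<Longrightarrow> y \<in> u"
    and snd_\<gamma>: "\<And>u. pmf (map_pmf snd \<gamma>) u = measure N {\<epsilon>\<in>space N. g \<epsilon> = u}"
  obtains \<pi> :: "'u \<Rightarrow> 'y measure"
  where "\<pi> \<in> N \<rightarrow>\<^sub>M prob_algebra (count_space UNIV)"
    and "AE \<epsilon> in N. measure (\<pi> \<epsilon>) (g \<epsilon>) = 1"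
    and "\<And>A. measure (map_pmf fst \<gamma>) A = (LINT \<epsilon>|N. measure (\<pi> \<epsilon>) A)"
proof
  interpret N: prob_space N by fact
  \<comment> \<open>This identity links the two descriptions of the predicted set: statements about
    \<epsilon> under \<open>N\<close> that depend only on \<open>g \<epsilon>\<close> become
    statements about the second marginal of \<gamma>, and integrals become finite sums.\<close>
  have law_g: "distr N (count_space UNIV) g = measure_pmf (map_pmf snd \<gamma>)"
  proof (rule measure_eqI_finite)
    fix u :: "'y set"
    have "g -` {u} \<inter> space N = {\<epsilon>\<in>space N. g \<epsilon> = u}" by auto
    then show "emeasure (distr N (count_space UNIV) g) {u} = emeasure (map_pmf snd \<gamma>) {u}"
      unfolding emeasure_pmf_single snd_\<gamma>
      by (simp add: emeasure_distr[OF g] N.emeasure_eq_measure)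
  qed auto
  show "(\<lambda>\<epsilon>. measure_pmf (conditional_fst \<gamma> (g \<epsilon>))) \<in> N \<rightarrow>\<^sub>M prob_algebra (count_space UNIV)"
    by (rule measurable_compose[OF g]) (simp add: space_prob_algebra prob_space_measure_pmf)
  \<comment> \<open>Only values \<open>u\<close> in the support of the second marginal matter here,
    so the unspecified conditional laws at null values are never examined. At the others, the
    support of the conditional law consists of \<open>y\<close> with \<open>(y, u)\<close> in the
    support of \<gamma>, hence of elements of \<open>u\<close>.\<close>
  have "AE u in distr N (count_space UNIV) g. measure (conditional_fst \<gamma> u) u = 1"
    unfolding law_g
    by (auto simp: AE_measure_pmf_iff measure_pmf.prob_eq_1 set_conditional_fst supp)
  then show "AE \<epsilon> in N. measure (conditional_fst \<gamma> (g \<epsilon>)) (g \<epsilon>) = 1"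
    by (simp add: AE_distr_iff)
  show "measure (map_pmf fst \<gamma>) A = (LINT \<epsilon>|N. measure (conditional_fst \<gamma> (g \<epsilon>)) A)" for A
  proof -
    have "(LINT \<epsilon>|N. measure (conditional_fst \<gamma> (g \<epsilon>)) A)
        = (LINT u|distr N (count_space UNIV) g. measure (conditional_fst \<gamma> u) A)"
      by (simp add: integral_distr)
    \<comment> \<open>From here the computation is the law of total probability: the multiplication
      rule removes the conditioning, and the slices \<open>A \<times> {u}\<close> partition the
      event that the outcome lies in \<open>A\<close>.\<close>
    also have "\<dots> = (\<Sum>u\<in>UNIV. pmf (map_pmf snd \<gamma>) u * measure (conditional_fst \<gamma> u) A)"
      unfolding law_g by (subst integral_measure_pmf[of UNIV]) auto
    also have "\<dots> = (\<Sum>u\<in>UNIV. measure \<gamma> (A \<times> {u}))"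
      by (simp add: measure_conditional_fst)
    also have "\<dots> = measure \<gamma> (\<Union>u. A \<times> {u})"
      by (intro measure_pmf.finite_measure_finite_Union[symmetric])
         (auto simp: disjoint_family_on_def)
    also have "(\<Union>u. A \<times> {u}) = fst -` A" by auto
    finally show ?thesis by simp
  qed
qed

section \<open>The equivalence at a single value of X\<close>

text \<open>The two constructions are fitted to the stated conditions. Two gaps have to be closed in
  the direction from couplings to kernels: the second marginal is prescribed only on
  \<open>predicted_sets g\<close>, and the first only on singletons, whereas compatibility concerns
  every \<open>A\<close>.\<close>

lemma selection_kernel_iff_coupling:
  fixes N :: "'u::polish_space measure" and g :: "'u \<Rightarrow> 'y::finite set" and p :: "'y measure"
  assumes N: "N \<in> space (prob_algebra borel)"
    and p: "p \<in> space (prob_algebra (count_space UNIV))"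
    and g: "measurable_correspondence g"
  shows "(\<exists>\<pi>. \<pi> \<in> borel \<rightarrow>\<^sub>M prob_algebra (count_space UNIV) \<and>
            (AE \<epsilon> in N. measure (\<pi> \<epsilon>) (g \<epsilon>) = 1) \<and>
            (\<forall>A. measure p A = (LINT \<epsilon>|N. measure (\<pi> \<epsilon>) A))) \<longleftrightarrow>
         (\<exists>\<gamma> :: ('y \<times> 'y set) pmf. set_pmf \<gamma> \<subseteq> admissible_pairs g \<and>
            (\<forall>y. pmf (map_pmf fst \<gamma>) y = measure p {y}) \<and>
            (\<forall>u\<in>predicted_sets g. pmf (map_pmf snd \<gamma>) u = predicted_mass N g u))"
    (is "?kernel \<longleftrightarrow> ?coupling")
proof -
  have prob: "prob_space N" and sets_N [measurable_cong]: "sets N = sets borel"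
    using N by (auto simp: space_prob_algebra)
  have space_N: "space N = UNIV"
    using sets_eq_imp_space_eq[OF sets_N] by simp
  have g_N: "g \<in> N \<rightarrow>\<^sub>M count_space UNIV"
    using measurable_correspondence_count_space[OF g] by measurable
  have kernel_N: "\<pi> \<in> N \<rightarrow>\<^sub>M K \<longleftrightarrow> \<pi> \<in> borel \<rightarrow>\<^sub>M K" for \<pi> and K :: "'y measure measure"
    by (simp add: measurable_cong_sets[OF sets_N refl])
  show ?thesis
  proof
    assume ?kernel
    then obtain \<pi> where \<pi>: "\<pi> \<in> N \<rightarrow>\<^sub>M prob_algebra (count_space UNIV)"
        "AE \<epsilon> in N. measure (\<pi> \<epsilon>) (g \<epsilon>) = 1" "\<And>A. measure p A = (LINT \<epsilon>|N. measure (\<pi> \<epsilon>) A)"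
      unfolding kernel_N by blast
    show ?coupling
      by (rule selection_kernel_imp_coupling[OF prob g_N \<pi>(1,2)], rule exI)
         (auto simp: \<pi>(3) space_N admissible_pairs_def predicted_sets_def predicted_mass_def)
  next
    assume ?coupling
    then obtain \<gamma> where supp: "set_pmf \<gamma> \<subseteq> admissible_pairs g"
      and fst_\<gamma>: "\<And>y. pmf (map_pmf fst \<gamma>) y = measure p {y}"
      and snd_\<gamma>: "\<And>u. u \<in> predicted_sets g \<Longrightarrow> pmf (map_pmf snd \<gamma>) u = predicted_mass N g u"
      by blast
    have snd_eq: "pmf (map_pmf snd \<gamma>) u = measure N {\<epsilon>\<in>space N. g \<epsilon> = u}" for u
    proof (cases "u \<in> predicted_sets g")
      case True
      then show ?thesis using snd_\<gamma> by (simp add: predicted_mass_def space_N)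
    next
      \<comment> \<open>Outside the range of \<open>g\<close> both masses are zero: on the left
        because \<gamma> charges only admissible pairs, on the right because the level set is
        empty.\<close>
      case False
      then have "u \<notin> snd ` set_pmf \<gamma>" using supp by (auto simp: admissible_pairs_def)
      moreover have "{\<epsilon>. g \<epsilon> = u} = {}" using False by (auto simp: predicted_sets_def)
      ultimately show ?thesis by (simp add: space_N pmf_eq_0_set_pmf)
    qed
    have "y \<in> u" if "(y, u) \<in> set_pmf \<gamma>" for y u
      using supp that by (auto simp: admissible_pairs_def)
    from coupling_imp_selection_kernel[OF prob g_N this snd_eq]
    obtain \<pi> where \<pi>: "\<pi> \<in> N \<rightarrow>\<^sub>M prob_algebra (count_space UNIV)"
        "AE \<epsilon> in N. measure (\<pi> \<epsilon>) (g \<epsilon>) = 1"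
        "\<And>A. measure (map_pmf fst \<gamma>) A = (LINT \<epsilon>|N. measure (\<pi> \<epsilon>) A)"
      by metis
    interpret p: prob_space p using p by (simp add: space_prob_algebra)
    \<comment> \<open>On a finite discrete space the singleton masses determine the measure, which
      upgrades the condition on the first marginal to all events.\<close>
    have "measure_pmf (map_pmf fst \<gamma>) = p"
    proof (rule measure_eqI_finite)
      show "sets p = Pow UNIV" using p by (simp add: space_prob_algebra)
      show "emeasure (map_pmf fst \<gamma>) {y} = emeasure p {y}" for y
        using fst_\<gamma>[of y] by (simp add: emeasure_pmf_single p.emeasure_eq_measure del: emeasure_map_pmf)
    qed auto
    with \<pi> show ?kernel unfolding kernel_N by metis
  qed
qed

section \<open>Passage to almost every value of X\<close>

text \<open>Existence is understood value by value: since \<open>f\<close> carries no measurability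
  requirement in \<open>x\<close>, a witness can be picked by Hilbert choice at each point, with an
  arbitrary value on the exceptional set.\<close>

lemma AE_choice: "(\<exists>f. AE x in L. Q x (f x)) \<longleftrightarrow> (AE x in L. \<exists>y. Q x y)"
proof
  assume "AE x in L. \<exists>y. Q x y"
  then have "AE x in L. Q x (SOME y. Q x y)" by eventually_elim (rule someI_ex)
  then show "\<exists>f. AE x in L. Q x (f x)" by (intro exI[of _ "\<lambda>x. SOME y. Q x y"])
qed (auto elim: eventually_mono)

theorem theorem3:
  fixes M :: "'w measure" and S :: "'x measure"
    and X :: "'w \<Rightarrow> 'x" and Y :: "'w \<Rightarrow> 'y::finite"
    and P :: "'x \<Rightarrow> 'y measure"
    and \<Theta> :: "(real ^ 'd) set"
    and \<nu> :: "'x \<Rightarrow> real ^ 'd \<Rightarrow> 'u::polish_space measure"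
    and G :: "'x \<Rightarrow> real ^ 'd \<Rightarrow> 'u \<Rightarrow> 'y set"
    and \<theta> :: "real ^ 'd"
  assumes "prob_space M"
    and "X \<in> M \<rightarrow>\<^sub>M S"
    and "Y \<in> M \<rightarrow>\<^sub>M count_space UNIV"
    and "conditional_distribution M S X Y P"
    and "open \<Theta>"
    and "\<And>x t. x \<in> space S \<Longrightarrow> t \<in> \<Theta> \<Longrightarrow> \<nu> x t \<in> space (prob_algebra borel)"
    and "AE x in distr M S X. \<forall>t\<in>\<Theta>. measurable_correspondence (G x t)"
    and "\<theta> \<in> \<Theta>"
  shows "\<theta> \<in> identified_set \<Theta> (distr M S X) P \<nu> G \<longleftrightarrow>
    (AE x in distr M S X.
       \<exists>\<gamma> :: ('y \<times> 'y set) pmf.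
         set_pmf \<gamma> \<subseteq> admissible_pairs (G x \<theta>) \<and>
         (\<forall>y. pmf (map_pmf fst \<gamma>) y = measure (P x) {y}) \<and>
         (\<forall>u\<in>predicted_sets (G x \<theta>).
            pmf (map_pmf snd \<gamma>) u = predicted_mass (\<nu> x \<theta>) (G x \<theta>) u))"
proof -
  let ?L = "distr M S X"
  have "P \<in> S \<rightarrow>\<^sub>M prob_algebra (count_space UNIV)"
    using assms(4) by (simp add: conditional_distribution_def)
  then have P: "P x \<in> space (prob_algebra (count_space UNIV))" if "x \<in> space S" for x
    using that by (rule measurable_space)
  \<comment> \<open>The support condition and compatibility are separate almost-sure statements
    about the same \<pi>. Merged into one, they have the shape required by
    \<open>AE_choice\<close>.\<close>
  have "\<theta> \<in> identified_set \<Theta> ?L P \<nu> G \<longleftrightarrow>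
      (\<exists>\<pi>. AE x in ?L. \<pi> x \<in> borel \<rightarrow>\<^sub>M prob_algebra (count_space UNIV) \<and>
         (AE \<epsilon> in \<nu> x \<theta>. measure (\<pi> x \<epsilon>) (G x \<theta> \<epsilon>) = 1) \<and>
         (\<forall>A. measure (P x) A = (LINT \<epsilon>|\<nu> x \<theta>. measure (\<pi> x \<epsilon>) A)))"
    using assms(8)
    by (simp add: identified_set_def selection_mechanism_def compatible_with_data_def)
  also have "\<dots> \<longleftrightarrow>
      (AE x in ?L. \<exists>k. k \<in> borel \<rightarrow>\<^sub>M prob_algebra (count_space UNIV) \<and>
         (AE \<epsilon> in \<nu> x \<theta>. measure (k \<epsilon>) (G x \<theta> \<epsilon>) = 1) \<and>
         (\<forall>A. measure (P x) A = (LINT \<epsilon>|\<nu> x \<theta>. measure (k \<epsilon>) A)))"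
    by (rule AE_choice)
  also have "\<dots> \<longleftrightarrow>
      (AE x in ?L. \<exists>\<gamma> :: ('y \<times> 'y set) pmf.
         set_pmf \<gamma> \<subseteq> admissible_pairs (G x \<theta>) \<and>
         (\<forall>y. pmf (map_pmf fst \<gamma>) y = measure (P x) {y}) \<and>
         (\<forall>u\<in>predicted_sets (G x \<theta>).
            pmf (map_pmf snd \<gamma>) u = predicted_mass (\<nu> x \<theta>) (G x \<theta>) u))"
    \<comment> \<open>The pointwise equivalence applies at almost every \<open>x\<close>: the
      correspondence is measurable almost surely, and membership of \<open>x\<close> in the space
      makes \<open>P x\<close> and \<open>\<nu> x \<theta>\<close> probability measures.\<close>
    using assms(7) AE_space
    by (intro eventually_subst, eventually_elim)
       (intro selection_kernel_iff_coupling; use P assms(6,8) in auto)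
  finally show ?thesis .
qed

end
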